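(* Let $\lambda_1,\lambda_2,\lambda_3\in\mathbb{R}$ and let $\mathbb{K}$ be the associated algebra of 3-parameter generalized quaternions. Let $p\in\mathbb{K}$ with $N_p=1$ have polar expression $p=\cos\theta+v\sin\theta$ with $v\in S^2_{\mathbb{K}}$, and suppose $m=\frac{2\pi}{\theta}\in\mathbb{Z}^{+}\setminus\{1\}$. Then for integers $n,s$: $n\equiv s\pmod m$ if and only if $p^n=p^s$.
   Context: Given $\lambda_1,\lambda_2,\lambda_3\in\mathbb{R}$, $\mathbb{K}$ is the (associative, unital) real algebra with vector-space basis $1,e_1,e_2,e_3$, unit $1$, and bilinear multiplication determined by $e_1^2=-\lambda_1\lambda_2$, $e_2^2=-\lambda_1\lambda_3$, $e_3^2=-\lambda_2\lambda_3$, $e_1e_2=\lambda_1e_3=-e_2e_1$, $e_2e_3=\lambda_3e_1=-e_3e_2$, $e_3e_1=\lambda_2e_2=-e_1e_3$. For $p=a_0+a_1e_1+a_2e_2+a_3e_3\in\mathbb{K}$ (with $a_i\in\mathbb{R}$), the conjugate is $\bar p=a_0-a_1e_1-a_2e_2-a_3e_3$ and the norm is $N_p=p\bar p=a_0^2+\lambda_1\lambda_2a_1^2+\lambda_1\lambda_3a_2^2+\lambda_2\lambda_3a_3^2$. When $N_p=1$, $p^{-1}=\bar p$, and negative powers are powers of $p^{-1}$. $\mathrm{Im}(\mathbb{K})=\{a_1e_1+a_2e_2+a_3e_3:a_i\in\mathbb{R}\}$ and $S^2_{\mathbb{K}}=\{h\in\mathrm{Im}(\mathbb{K}):N_h=1\}$.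 *)

theory Defs
  imports Complex_Main "HOL-Algebra.Ring" "HOL-Number_Theory.Cong"
begin

(* GQ a0 a1 a2 a3 stands for a0 + a1 e1 + a2 e2 + a3 e3.  The underlying real vector space
   does not depend on the parameters, only the multiplication does; hence the vector space
   structure is given by type classes and the ring structure by a HOL-Algebra record. *)

datatype gquat = GQ (gq0: real) (gq1: real) (gq2: real) (gq3: real)

lemma gquat_eq_iff:
  "p = q \<longleftrightarrow> gq0 p = gq0 q \<and> gq1 p = gq1 q \<and> gq2 p = gq2 q \<and> gq3 p = gq3 q"
  by (cases p; cases q) simp

instantiation gquat :: real_vector
begin

definition "0 = GQ 0 0 0 0"
definition "p + q = GQ (gq0 p + gq0 q) (gq1 p + gq1 q) (gq2 p + gq2 q) (gq3 p + gq3 q)"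
definition "- p = GQ (- gq0 p) (- gq1 p) (- gq2 p) (- gq3 p)"
definition "p - q = GQ (gq0 p - gq0 q) (gq1 p - gq1 q) (gq2 p - gq2 q) (gq3 p - gq3 q)"
definition "r *\<^sub>R p = GQ (r * gq0 p) (r * gq1 p) (r * gq2 p) (r * gq3 p)"

instance
  by standard
    (simp_all add: zero_gquat_def plus_gquat_def uminus_gquat_def minus_gquat_def
      scaleR_gquat_def gquat_eq_iff algebra_simps)

end

lemmas gquat_defs =
  zero_gquat_def plus_gquat_def uminus_gquat_def minus_gquat_def scaleR_gquat_def

(* Bilinear extension of the multiplication table proved in gquat_table below. *)

definition gq_mult :: "real \<Rightarrow> real \<Rightarrow> real \<Rightarrow> gquat \<Rightarrow> gquat \<Rightarrow> gquat" where
  "gq_mult l1 l2 l3 p q = GQ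
    (gq0 p * gq0 q - l1 * l2 * gq1 p * gq1 q - l1 * l3 * gq2 p * gq2 q - l2 * l3 * gq3 p * gq3 q)
    (gq0 p * gq1 q + gq1 p * gq0 q + l3 * (gq2 p * gq3 q - gq3 p * gq2 q))
    (gq0 p * gq2 q + gq2 p * gq0 q + l2 * (gq3 p * gq1 q - gq1 p * gq3 q))
    (gq0 p * gq3 q + gq3 p * gq0 q + l1 * (gq1 p * gq2 q - gq2 p * gq1 q))"

definition gquat_ring :: "real \<Rightarrow> real \<Rightarrow> real \<Rightarrow> gquat ring" where
  "gquat_ring l1 l2 l3 =
    \<lparr>carrier = UNIV, monoid.mult = gq_mult l1 l2 l3, one = GQ 1 0 0 0, zero = 0, add = (+)\<rparr>"

definition gq_conj :: "gquat \<Rightarrow> gquat" where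
  "gq_conj p = GQ (gq0 p) (- gq1 p) (- gq2 p) (- gq3 p)"

definition gq_norm :: "real \<Rightarrow> real \<Rightarrow> real \<Rightarrow> gquat \<Rightarrow> real" where
  "gq_norm l1 l2 l3 p =
    (gq0 p)\<^sup>2 + l1 * l2 * (gq1 p)\<^sup>2 + l1 * l3 * (gq2 p)\<^sup>2 + l2 * l3 * (gq3 p)\<^sup>2"

definition gq_Im :: "gquat set" where
  "gq_Im = {GQ 0 a1 a2 a3 | a1 a2 a3. True}"

definition gq_sphere :: "real \<Rightarrow> real \<Rightarrow> real \<Rightarrow> gquat set" where
  "gq_sphere l1 l2 l3 = {h \<in> gq_Im. gq_norm l1 l2 l3 h = 1}"

lemma gquat_ring_simps [simp]:
  "carrier (gquat_ring l1 l2 l3) = UNIV"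
  "p \<otimes>\<^bsub>gquat_ring l1 l2 l3\<^esub> q = gq_mult l1 l2 l3 p q"
  "\<one>\<^bsub>gquat_ring l1 l2 l3\<^esub> = GQ 1 0 0 0"
  "\<zero>\<^bsub>gquat_ring l1 l2 l3\<^esub> = 0"
  "p \<oplus>\<^bsub>gquat_ring l1 l2 l3\<^esub> q = p + q"
  by (simp_all add: gquat_ring_def)

lemma gquat_table:
  fixes l1 l2 l3 :: real
  defines "e1 \<equiv> GQ 0 1 0 0" and "e2 \<equiv> GQ 0 0 1 0" and "e3 \<equiv> GQ 0 0 0 1"
    and "u \<equiv> GQ 1 0 0 0" and "K \<equiv> gquat_ring l1 l2 l3"
  shows "e1 \<otimes>\<^bsub>K\<^esub> e1 = (- (l1 * l2)) *\<^sub>R u"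
    and "e2 \<otimes>\<^bsub>K\<^esub> e2 = (- (l1 * l3)) *\<^sub>R u"
    and "e3 \<otimes>\<^bsub>K\<^esub> e3 = (- (l2 * l3)) *\<^sub>R u"
    and "e1 \<otimes>\<^bsub>K\<^esub> e2 = l1 *\<^sub>R e3" and "e2 \<otimes>\<^bsub>K\<^esub> e1 = - (l1 *\<^sub>R e3)"
    and "e2 \<otimes>\<^bsub>K\<^esub> e3 = l3 *\<^sub>R e1" and "e3 \<otimes>\<^bsub>K\<^esub> e2 = - (l3 *\<^sub>R e1)"
    and "e3 \<otimes>\<^bsub>K\<^esub> e1 = l2 *\<^sub>R e2" and "e1 \<otimes>\<^bsub>K\<^esub> e3 = - (l2 *\<^sub>R e2)"
  by (simp_all add: assms gq_mult_def gquat_defs)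

lemma gq_mult_bilinear:
  "gq_mult l1 l2 l3 (p + q) r = gq_mult l1 l2 l3 p r + gq_mult l1 l2 l3 q r"
  "gq_mult l1 l2 l3 r (p + q) = gq_mult l1 l2 l3 r p + gq_mult l1 l2 l3 r q"
  "gq_mult l1 l2 l3 (c *\<^sub>R p) q = c *\<^sub>R gq_mult l1 l2 l3 p q"
  "gq_mult l1 l2 l3 p (c *\<^sub>R q) = c *\<^sub>R gq_mult l1 l2 l3 p q"
  by (simp_all add: gq_mult_def gquat_defs algebra_simps)

lemma ring_gquat_ring: "ring (gquat_ring l1 l2 l3)"
proof (rule ringI)
  have "\<exists>q. q + p = 0" for p :: gquat
    by (rule exI [of _ "- p"]) simp
  then show "abelian_group (gquat_ring l1 l2 l3)"
    by (intro abelian_groupI) (auto simp: add_ac)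
  show "monoid (gquat_ring l1 l2 l3)"
    by (intro monoidI) (simp_all add: gq_mult_def gquat_eq_iff algebra_simps)
qed (simp_all add: gq_mult_bilinear)

lemma gq_mult_conj:
  "p \<otimes>\<^bsub>gquat_ring l1 l2 l3\<^esub> gq_conj p = gq_norm l1 l2 l3 p *\<^sub>R \<one>\<^bsub>gquat_ring l1 l2 l3\<^esub>"
  "gq_conj p \<otimes>\<^bsub>gquat_ring l1 l2 l3\<^esub> p = gq_norm l1 l2 l3 p *\<^sub>R \<one>\<^bsub>gquat_ring l1 l2 l3\<^esub>"
  by (simp_all add: gq_mult_def gq_conj_def gq_norm_def gquat_defs algebra_simps power2_eq_square)

lemma gq_inv:
  assumes "gq_norm l1 l2 l3 p = 1"
  shows "p \<in> Units (gquat_ring l1 l2 l3)"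
    and "inv\<^bsub>gquat_ring l1 l2 l3\<^esub> p = gq_conj p"
proof -
  interpret ring "gquat_ring l1 l2 l3" by (rule ring_gquat_ring)
  have *: "p \<otimes>\<^bsub>gquat_ring l1 l2 l3\<^esub> gq_conj p = \<one>\<^bsub>gquat_ring l1 l2 l3\<^esub>"
    "gq_conj p \<otimes>\<^bsub>gquat_ring l1 l2 l3\<^esub> p = \<one>\<^bsub>gquat_ring l1 l2 l3\<^esub>"
    unfolding gq_mult_conj assms by simp_all
  show "p \<in> Units (gquat_ring l1 l2 l3)"
    using * by (auto simp: Units_def simp del: gquat_ring_simps(2,3))
  show "inv\<^bsub>gquat_ring l1 l2 l3\<^esub> p = gq_conj p"
    by (rule inv_char [OF _ _ *]) simp_all
qed

(* HOL-Algebra defines a negative power as the inverse of the positive one;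
   here this is the positive power of the inverse, i.e. of the conjugate. *)

lemma gq_int_pow_neg:
  assumes "gq_norm l1 l2 l3 p = 1"
  shows "p [^]\<^bsub>gquat_ring l1 l2 l3\<^esub> (- int k) = gq_conj p [^]\<^bsub>gquat_ring l1 l2 l3\<^esub> k"
proof -
  interpret ring "gquat_ring l1 l2 l3" by (rule ring_gquat_ring)
  let ?K = "gquat_ring l1 l2 l3"
  have 1: "p \<otimes>\<^bsub>?K\<^esub> gq_conj p = \<one>\<^bsub>?K\<^esub>" "gq_conj p \<otimes>\<^bsub>?K\<^esub> p = \<one>\<^bsub>?K\<^esub>"
    unfolding gq_mult_conj assms by simp_all
  have c: "x \<in> carrier ?K" for x by simp
  have comm: "p [^]\<^bsub>?K\<^esub> k \<otimes>\<^bsub>?K\<^esub> gq_conj p [^]\<^bsub>?K\<^esub> k = \<one>\<^bsub>?K\<^esub>"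
    "gq_conj p [^]\<^bsub>?K\<^esub> k \<otimes>\<^bsub>?K\<^esub> p [^]\<^bsub>?K\<^esub> k = \<one>\<^bsub>?K\<^esub>" for k :: nat
    using pow_mult_distrib [of p "gq_conj p" k, OF _ c c]
      pow_mult_distrib [of "gq_conj p" p k, OF _ c c] 1 nat_pow_one
    by (simp_all del: gquat_ring_simps)
  have "inv\<^bsub>?K\<^esub> (p [^]\<^bsub>?K\<^esub> k) = gq_conj p [^]\<^bsub>?K\<^esub> k"
    by (rule inv_char [OF c c comm])
  moreover have "p [^]\<^bsub>?K\<^esub> (- int k) = inv\<^bsub>?K\<^esub> (p [^]\<^bsub>?K\<^esub> k)"
  proof (cases "k = 0")
    case True
    then show ?thesis using inv_one by (simp add: int_pow_def2 del: gquat_ring_simps)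
  next
    case False
    then show ?thesis by (simp add: int_pow_def2 del: gquat_ring_simps)
  qed
  ultimately show ?thesis by simp
qed

end

theory Submission
  imports Defs
begin

text \<open>
  An imaginary \<open>v\<close> of norm 1 is a square root of \<open>-1\<close>, whatever the signs of the parameters.
  Hence the span of \<open>1\<close> and \<open>v\<close> is a copy of the complex numbers, in which
  \<open>cos t + v sin t\<close> plays the role of \<open>exp (i t)\<close>. De Moivre's formula
  (\<open>polar_nat_pow\<close>, extended to negative exponents in \<open>polar_int_pow\<close>) then gives
  \<open>p\<^sup>n = cos (n \<theta>) + v sin (n \<theta>)\<close>, and since \<open>1\<close> and \<open>v\<close> are linearly independent, two such
  expressions agree only if the angles differ by a multiple of \<open>2 \<pi>\<close> (\<open>polar_eq_iff\<close>). For
  \<open>\<theta> = 2 \<pi> / m\<close> the angles \<open>n \<theta>\<close> and \<open>s \<theta>\<close> differ by a multiple of \<open>2 \<pi>\<close> exactly when \<open>m\<close>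
  divides \<open>n - s\<close>.
\<close>

definition polar :: "gquat \<Rightarrow> real \<Rightarrow> gquat" where
  "polar v t = cos t *\<^sub>R GQ 1 0 0 0 + sin t *\<^sub>R v"

lemma gq_sphere_square:
  assumes "v \<in> gq_sphere l1 l2 l3"
  shows "gq_mult l1 l2 l3 v v = - GQ 1 0 0 0"
  using assms
  by (auto simp: gq_sphere_def gq_Im_def gq_norm_def gq_mult_def gquat_defs
      power2_eq_square algebra_simps)

text \<open>With \<open>v\<^sup>2 = -1\<close>, expanding the product leaves the addition formulas for cosine and sine.\<close>

lemma polar_mult:
  assumes "v \<in> gq_sphere l1 l2 l3"
  shows "gq_mult l1 l2 l3 (polar v s) (polar v t) = polar v (s + t)"
proof -
  have unit: "gq_mult l1 l2 l3 (GQ 1 0 0 0) q = q" "gq_mult l1 l2 l3 q (GQ 1 0 0 0) = q" for q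
    by (simp_all add: gq_mult_def)
  show ?thesis
    by (simp add: polar_def gq_mult_bilinear unit gq_sphere_square [OF assms]
        cos_add sin_add algebra_simps)
qed

lemma polar_zero: "polar v 0 = GQ 1 0 0 0"
  by (simp add: polar_def)

lemma gq_conj_polar:
  assumes "v \<in> gq_sphere l1 l2 l3"
  shows "gq_conj (polar v t) = polar v (- t)"
  using assms by (auto simp: gq_sphere_def gq_Im_def gq_conj_def polar_def gquat_defs)

lemma gq_norm_polar:
  assumes "v \<in> gq_sphere l1 l2 l3"
  shows "gq_norm l1 l2 l3 (polar v t) = 1"
proof -
  have "gq_norm l1 l2 l3 (polar v t) *\<^sub>R GQ 1 0 0 0 = GQ 1 0 0 0"
    using gq_mult_conj(1) [of l1 l2 l3 "polar v t"]
    by (simp add: gq_conj_polar [OF assms] polar_mult [OF assms] polar_zero)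
  then show ?thesis
    by (simp add: gquat_defs)
qed

lemma polar_nat_pow:
  assumes "v \<in> gq_sphere l1 l2 l3"
  shows "polar v t [^]\<^bsub>gquat_ring l1 l2 l3\<^esub> (k::nat) = polar v (real k * t)"
proof (induction k)
  case 0
  then show ?case by (simp add: polar_zero)
next
  case (Suc k)
  then show ?case by (simp add: polar_mult [OF assms] algebra_simps)
qed

lemma polar_int_pow:
  assumes "v \<in> gq_sphere l1 l2 l3"
  shows "polar v t [^]\<^bsub>gquat_ring l1 l2 l3\<^esub> (n::int) = polar v (real_of_int n * t)"
proof (cases n rule: int_cases2)
  case (nonneg k)
  then show ?thesis by (simp add: int_pow_int polar_nat_pow [OF assms])
next
  case (nonpos k)
  then show ?thesis
    by (simp add: gq_int_pow_neg [OF gq_norm_polar [OF assms]] gq_conj_polar [OF assms]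
        polar_nat_pow [OF assms])
qed

text \<open>
  Comparing real parts identifies the cosines; the imaginary parts identify the sines because
  \<open>v\<close>, having norm 1, does not vanish.
\<close>

lemma polar_eq_iff:
  assumes "v \<in> gq_sphere l1 l2 l3"
  shows "polar v s = polar v t \<longleftrightarrow> (\<exists>k::int. s = t + 2 * pi * k)"
proof -
  have "polar v s = polar v t \<longleftrightarrow> sin s = sin t \<and> cos s = cos t"
    using assms
    by (auto simp: gq_sphere_def gq_Im_def gq_norm_def polar_def gquat_defs)
  then show ?thesis
    by (simp add: sin_cos_eq_iff)
qed

theorem theorem4p6:
  fixes l1 l2 l3 \<theta> :: real and p v :: gquat and m n s :: int
  assumes "gq_norm l1 l2 l3 p = 1"
    and "v \<in> gq_sphere l1 l2 l3"
    and "p = cos \<theta> *\<^sub>R \<one>\<^bsub>gquat_ring l1 l2 l3\<^esub> + sin \<theta> *\<^sub>R v"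
    and "2 * pi / \<theta> = of_int m" and "m > 0" and "m \<noteq> 1"
  shows "[n = s] (mod m) \<longleftrightarrow>
    p [^]\<^bsub>gquat_ring l1 l2 l3\<^esub> n = p [^]\<^bsub>gquat_ring l1 l2 l3\<^esub> s"
proof -
  have p: "p = polar v \<theta>"
    using assms(3) by (simp add: polar_def)
  \<comment> \<open>Division by zero gives \<open>0\<close>, so the positivity of \<open>m\<close> is what excludes \<open>\<theta> = 0\<close>.\<close>
  have "\<theta> \<noteq> 0"
    using assms(4,5) by auto
  then have period: "2 * pi = real_of_int m * \<theta>"
    using assms(4) by (simp add: field_simps)
  have angles: "real_of_int n * \<theta> = real_of_int s * \<theta> + 2 * pi * real_of_int k \<longleftrightarrow> n = s + m * k"
    for k :: int
  proof -
    have "real_of_int s * \<theta> + 2 * pi * real_of_int k = real_of_int (s + m * k) * \<theta>"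
      unfolding period by (simp add: algebra_simps)
    then show ?thesis
      using \<open>\<theta> \<noteq> 0\<close> by (simp only: mult_cancel_right of_int_eq_iff simp_thms)
  qed
  have "p [^]\<^bsub>gquat_ring l1 l2 l3\<^esub> n = p [^]\<^bsub>gquat_ring l1 l2 l3\<^esub> s \<longleftrightarrow> (\<exists>k. n = s + m * k)"
    by (simp only: p polar_int_pow [OF assms(2)] polar_eq_iff [OF assms(2)] angles)
  also have "\<dots> \<longleftrightarrow> [n = s] (mod m)"
    by (auto simp: cong_iff_dvd_diff dvd_def algebra_simps)
  finally show ?thesis by simp
qed

end
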